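(* Let $A(x,y)=A_0+\sum_{p=1}^dx_pA_p+\sum_{q=1}^my_qA'_q\in\mathcal{S}^k[x,y]$ and $B(x)=B_0+\sum_{p=1}^dx_pB_p\in\mathcal{S}^l[x]$ be linear pencils. In every assertion concerning $\widehat{\Phi}_{AB}$ assume that $A_1,\dots,A_d,A'_1,\dots,A'_m$ are linearly independent, and in every assertion concerning $\Phi_{AB}$ assume that $A_0,A_1,\dots,A_d,A'_1,\dots,A'_m$ are linearly independent (so that the respective map is well-defined). (1) If $\Phi_{AB}$ or $\widehat{\Phi}_{AB}$ is positive, then $\pi(S_A)\subseteq S_B$. (2) If $\pi(S_A)\neq\emptyset$, then $\pi(S_A)\subseteq S_B$ implies positivity of $\widehat{\Phi}_{AB}$. (3) If $\pi(S_A)\neq\emptyset$ and $S_A$ is bounded, then $\pi(S_A)\subseteq S_B$ implies positivity of $\Phi_{AB}$.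
   Context: $\mathcal{S}^k$ is the space of real symmetric $k\times k$ matrices, $\mathcal{S}^k_+$ the cone of positive semidefinite ones. A linear pencil is a matrix polynomial of degree at most one with symmetric coefficients, as displayed. $S_A=\{(x,y)\in\mathbb{R}^{d+m}\mid A(x,y)\succeq0\}$, $\pi(S_A)=\{x\in\mathbb{R}^d\mid\exists y\in\mathbb{R}^m:\ A(x,y)\succeq0\}$, $S_B=\{x\in\mathbb{R}^d\mid B(x)\succeq0\}$. Set $\mathcal{A}=\operatorname{span}\{A_0,\dots,A_d,A'_1,\dots,A'_m\}\subseteq\mathcal{S}^k$, $\mathcal{B}=\operatorname{span}\{B_0,\dots,B_d\}\subseteq\mathcal{S}^l$, and $\widehat{\mathcal{A}}=\operatorname{span}\{1\oplus A_0,\,0\oplus A_1,\dots,0\oplus A_d,\,0\oplus A'_1,\dots,0\oplus A'_m\}\subseteq\mathcal{S}^{k+1}$, where $\oplus$ denotes the block diagonal sum (with a $1\times1$ first block). If $A_1,\dots,A_d,A'_1,\dots,A'_m$ are linearly independent, $\widehat{\Phi}_{AB}:\widehat{\mathcal{A}}\to\mathcal{B}$ is the linear map with $\widehat{\Phi}_{AB}(1\oplus A_0)=B_0$, $\widehat{\Phi}_{AB}(0\oplus A_p)=B_p$ for $p=1,\dots,d$, and $\widehat{\Phi}_{AB}(0\oplus A'_q)=0$ for $q=1,\dots,m$. If $A_0,\dots,A_d,A'_1,\dots,A'_m$ are linearly independent, $\Phi_{AB}:\mathcal{A}\to\mathcal{B}$ is the linear map with $\Phi_{AB}(A_p)=B_p$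 for $p=0,\dots,d$, and $\Phi_{AB}(A'_q)=0$ for $q=1,\dots,m$. Such a map is called positive if it maps every positive semidefinite matrix in its domain to a positive semidefinite matrix. *)

theory Defs
  imports "HOL-Analysis.Analysis"
begin

(* The number variables d and m are natural numbers, so that d = 0 or m = 0 (no y-variables) is
   allowed; hence a vector of R^n is an extensional function on {1..n}. *)
abbreviation Rn :: "nat \<Rightarrow> (nat \<Rightarrow> real) set" where
  "Rn n \<equiv> {1..n} \<rightarrow>\<^sub>E UNIV"

definition symmetric_matrix :: "real^'n^'n \<Rightarrow> bool" where
  "symmetric_matrix M \<longleftrightarrow> transpose M = M"

definition psd :: "real^'n^'n \<Rightarrow> bool" where
  "psd M \<longleftrightarrow> symmetric_matrix M \<and> (\<forall>v. v \<bullet> (M *v v) \<ge> 0)"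

definition block_sum :: "real^'a^'a \<Rightarrow> real^'b^'b \<Rightarrow> real^('a + 'b)^('a + 'b)"  (infixr "\<oplus>\<^sub>m" 66) where
  "M \<oplus>\<^sub>m N = (\<chi> i j. case (i, j) of
      (Inl a, Inl a') \<Rightarrow> M $ a $ a'
    | (Inr b, Inr b') \<Rightarrow> N $ b $ b'
    | _ \<Rightarrow> 0)"


definition pencil :: "nat \<Rightarrow> (nat \<Rightarrow> real^'n^'n) \<Rightarrow> (nat \<Rightarrow> real) \<Rightarrow> real^'n^'n" where
  "pencil d B x = B 0 + (\<Sum>p=1..d. x p *\<^sub>R B p)"

definition pencil2 ::
  "nat \<Rightarrow> nat \<Rightarrow> (nat \<Rightarrow> real^'n^'n) \<Rightarrow> (nat \<Rightarrow> real^'n^'n) \<Rightarrow> (nat \<Rightarrow> real) \<Rightarrow> (nat \<Rightarrow> real) \<Rightarrow> real^'n^'n" where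
  "pencil2 d m A A' x y = A 0 + (\<Sum>p=1..d. x p *\<^sub>R A p) + (\<Sum>q=1..m. y q *\<^sub>R A' q)"

definition spectrahedron :: "nat \<Rightarrow> (nat \<Rightarrow> real^'n^'n) \<Rightarrow> (nat \<Rightarrow> real) set" where
  "spectrahedron d B = {x \<in> Rn d. psd (pencil d B x)}"

definition spectrahedron2 ::
  "nat \<Rightarrow> nat \<Rightarrow> (nat \<Rightarrow> real^'n^'n) \<Rightarrow> (nat \<Rightarrow> real^'n^'n) \<Rightarrow> ((nat \<Rightarrow> real) \<times> (nat \<Rightarrow> real)) set" where
  "spectrahedron2 d m A A' = {(x, y) \<in> Rn d \<times> Rn m. psd (pencil2 d m A A' x y)}"

definition proj_spectrahedron ::
  "nat \<Rightarrow> nat \<Rightarrow> (nat \<Rightarrow> real^'n^'n) \<Rightarrow> (nat \<Rightarrow> real^'n^'n) \<Rightarrow> (nat \<Rightarrow> real) set" where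
  "proj_spectrahedron d m A A' = {x \<in> Rn d. \<exists>y \<in> Rn m. psd (pencil2 d m A A' x y)}"

(* Boundedness in the Euclidean norm of R^(d+m). The library's bounded cannot be used here: the
   metric of Function_Metric on functions is bounded, so every set of functions is bounded. *)
definition bounded_pairs :: "nat \<Rightarrow> nat \<Rightarrow> ((nat \<Rightarrow> real) \<times> (nat \<Rightarrow> real)) set \<Rightarrow> bool" where
  "bounded_pairs d m S \<longleftrightarrow>
     (\<exists>C. \<forall>(x, y) \<in> S. sqrt ((\<Sum>p=1..d. (x p)\<^sup>2) + (\<Sum>q=1..m. (y q)\<^sup>2)) \<le> C)"


(* Linear independence of an indexed family: repeated members make it dependent. *)
definition lin_indep_family :: "'i set \<Rightarrow> ('i \<Rightarrow> 'v::real_vector) \<Rightarrow> bool" where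
  "lin_indep_family I F \<longleftrightarrow> inj_on F I \<and> independent (F ` I)"

(* The linear map with F i \<mapsto> G i for i in I. It is meaningful on span (F ` I) when
   the family F is independent; construct extends it to a linear map on the whole space, and
   only its restriction to span (F ` I) is of interest. *)
definition linear_map_of ::
  "'i set \<Rightarrow> ('i \<Rightarrow> 'v::real_vector) \<Rightarrow> ('i \<Rightarrow> 'w::real_vector) \<Rightarrow> 'v \<Rightarrow> 'w" where
  "linear_map_of I F G = real_vector.construct (F ` I) (\<lambda>v. G (the_inv_into I F v))"

lemma linear_linear_map_of:
  assumes "lin_indep_family I F"
  shows "linear (linear_map_of I F G)"
  using assms unfolding lin_indep_family_def linear_map_of_def
  by (intro real_vector.linear_construct) auto

lemma linear_map_of_apply:
  assumes "lin_indep_family I F" "i \<in> I"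
  shows "linear_map_of I F G (F i) = G i"
  using assms unfolding lin_indep_family_def linear_map_of_def
  by (simp add: real_vector.construct_basis the_inv_into_f_f)

lemma linear_map_of_unique:
  assumes "lin_indep_family I F" "linear f" "\<And>i. i \<in> I \<Longrightarrow> f (F i) = G i" "X \<in> span (F ` I)"
  shows "linear_map_of I F G X = f X"
  by (rule linear_eq_on_span[OF linear_linear_map_of[OF assms(1)] assms(2) _ assms(4)])
    (use assms(1,3) in \<open>auto simp: linear_map_of_apply\<close>)

lemma linear_map_of_in_span:
  assumes "lin_indep_family I F"
  shows "linear_map_of I F G X \<in> span (G ` I)"
proof -
  have "linear_map_of I F G X \<in> span ((\<lambda>v. G (the_inv_into I F v)) ` F ` I)"
    using assms unfolding lin_indep_family_def linear_map_of_def
    by (intro real_vector.construct_in_span) auto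
  also have "(\<lambda>v. G (the_inv_into I F v)) ` F ` I = G ` I"
    using assms unfolding lin_indep_family_def by (force simp: the_inv_into_f_f)
  finally show ?thesis .
qed


(* Inl p indexes A_p and Inr q indexes A'_q. *)
abbreviation Phi_index :: "nat \<Rightarrow> nat \<Rightarrow> (nat + nat) set" where
  "Phi_index d m \<equiv> {0..d} <+> {1..m}"

definition hat_coeffs ::
  "(nat \<Rightarrow> real^'k^'k) \<Rightarrow> (nat \<Rightarrow> real^'k^'k) \<Rightarrow> nat + nat \<Rightarrow> real^(1 + 'k)^(1 + 'k)" where
  "hat_coeffs A A' = case_sum
     (\<lambda>p. (if p = 0 then mat 1 else 0 :: real^1^1) \<oplus>\<^sub>m A p)
     (\<lambda>q. (0 :: real^1^1) \<oplus>\<^sub>m A' q)"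

definition calA :: "nat \<Rightarrow> nat \<Rightarrow> (nat \<Rightarrow> real^'k^'k) \<Rightarrow> (nat \<Rightarrow> real^'k^'k) \<Rightarrow> (real^'k^'k) set" where
  "calA d m A A' = span (case_sum A A' ` Phi_index d m)"

definition hat_calA ::
  "nat \<Rightarrow> nat \<Rightarrow> (nat \<Rightarrow> real^'k^'k) \<Rightarrow> (nat \<Rightarrow> real^'k^'k) \<Rightarrow> (real^(1 + 'k)^(1 + 'k)) set" where
  "hat_calA d m A A' = span (hat_coeffs A A' ` Phi_index d m)"

definition calB :: "nat \<Rightarrow> (nat \<Rightarrow> real^'l^'l) \<Rightarrow> (real^'l^'l) set" where
  "calB d B = span (B ` {0..d})"

definition Phi ::
  "nat \<Rightarrow> nat \<Rightarrow> (nat \<Rightarrow> real^'k^'k) \<Rightarrow> (nat \<Rightarrow> real^'k^'k) \<Rightarrow> (nat \<Rightarrow> real^'l^'l) \<Rightarrow> real^'k^'k \<Rightarrow> real^'l^'l" where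
  "Phi d m A A' B = linear_map_of (Phi_index d m) (case_sum A A') (case_sum B (\<lambda>q. 0))"

definition hat_Phi ::
  "nat \<Rightarrow> nat \<Rightarrow> (nat \<Rightarrow> real^'k^'k) \<Rightarrow> (nat \<Rightarrow> real^'k^'k) \<Rightarrow> (nat \<Rightarrow> real^'l^'l) \<Rightarrow>
     real^(1 + 'k)^(1 + 'k) \<Rightarrow> real^'l^'l" where
  "hat_Phi d m A A' B = linear_map_of (Phi_index d m) (hat_coeffs A A') (case_sum B (\<lambda>q. 0))"

definition positive_on :: "(real^'a^'a) set \<Rightarrow> (real^'a^'a \<Rightarrow> real^'b^'b) \<Rightarrow> bool" where
  "positive_on V f \<longleftrightarrow> (\<forall>X \<in> V. psd X \<longrightarrow> psd (f X))"

definition indep_Phi :: "nat \<Rightarrow> nat \<Rightarrow> (nat \<Rightarrow> real^'k^'k) \<Rightarrow> (nat \<Rightarrow> real^'k^'k) \<Rightarrow> bool" where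
  "indep_Phi d m A A' \<longleftrightarrow> lin_indep_family ({0..d} <+> {1..m}) (case_sum A A')"

definition indep_hat_Phi :: "nat \<Rightarrow> nat \<Rightarrow> (nat \<Rightarrow> real^'k^'k) \<Rightarrow> (nat \<Rightarrow> real^'k^'k) \<Rightarrow> bool" where
  "indep_hat_Phi d m A A' \<longleftrightarrow> lin_indep_family ({1..d} <+> {1..m}) (case_sum A A')"


lemma lin_indep_family_iff:
  assumes "finite I"
  shows "lin_indep_family I F \<longleftrightarrow> (\<forall>c. (\<Sum>i\<in>I. c i *\<^sub>R F i) = 0 \<longrightarrow> (\<forall>i\<in>I. c i = 0))"
proof safe
  fix c i assume *: "lin_indep_family I F" "(\<Sum>i\<in>I. c i *\<^sub>R F i) = 0" "i \<in> I"
  let ?g = "\<lambda>v. c (the_inv_into I F v)"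
  have "(\<Sum>v\<in>F ` I. ?g v *\<^sub>R v) = (\<Sum>i\<in>I. c i *\<^sub>R F i)"
    using *(1) by (subst sum.reindex) (auto simp: lin_indep_family_def the_inv_into_f_f intro!: sum.cong)
  hence "?g (F i) = 0"
    using *(1,2,3) assms independentD[of "F ` I" "F ` I" ?g "F i"] by (auto simp: lin_indep_family_def)
  thus "c i = 0" using * by (simp add: lin_indep_family_def the_inv_into_f_f)
next
  assume *: "\<forall>c. (\<Sum>i\<in>I. c i *\<^sub>R F i) = 0 \<longrightarrow> (\<forall>i\<in>I. c i = 0)"
  have inj: "inj_on F I"
  proof (rule inj_onI, rule ccontr)
    fix i j assume ij: "i \<in> I" "j \<in> I" "F i = F j" "i \<noteq> j"
    let ?c = "\<lambda>k. (if k = i then 1 else 0) - (if k = j then 1 else 0 :: real)"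
    have "(\<Sum>k\<in>I. ?c k *\<^sub>R F k) =
      (\<Sum>k\<in>I. if k = i then F k else 0) - (\<Sum>k\<in>I. if k = j then F k else 0)"
      unfolding sum_subtractf[symmetric] by (rule sum.cong) (auto)
    also have "\<dots> = 0" using ij assms by simp
    finally have "\<forall>k\<in>I. ?c k = 0" using *[rule_format, of ?c] by blast
    hence "?c i = 0" using ij(1) by (rule bspec)
    thus False using ij by simp
  qed
  have "independent (F ` I)"
  proof (rule independent_if_scalars_zero)
    show "finite (F ` I)" using assms by simp
    fix g v assume g: "(\<Sum>v\<in>F ` I. g v *\<^sub>R v) = 0" "v \<in> F ` I"
    have "(\<Sum>i\<in>I. g (F i) *\<^sub>R F i) = 0"
      using g(1) inj by (simp add: sum.reindex)
    thus "g v = 0" using * g(2) by (metis imageE)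
  qed
  with inj show "lin_indep_family I F" by (simp add: lin_indep_family_def)
qed

lemma sum_coeffs:
  fixes d m :: nat
  shows "(\<Sum>i\<in>{0..d} <+> {1..m}. c i *\<^sub>R case_sum F G i) =
   c (Inl 0) *\<^sub>R F 0 + (\<Sum>p=1..d. c (Inl p) *\<^sub>R F p) + (\<Sum>q=1..m. c (Inr q) *\<^sub>R G q)"
  using sum.atLeast_Suc_atMost[of 0 d "\<lambda>p. c (Inl p) *\<^sub>R F p"]
  by (simp add: sum.Plus comp_def add.assoc)

lemma hat_coeffs_indep:
  assumes "indep_hat_Phi d m A A'"
  shows "lin_indep_family (Phi_index d m) (hat_coeffs A A')"
  unfolding lin_indep_family_iff[OF finite_Plus[OF finite_atLeastAtMost finite_atLeastAtMost]]
proof (intro allI impI)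
  fix c assume *: "(\<Sum>i\<in>Phi_index d m. c i *\<^sub>R hat_coeffs A A' i) = 0"
  have "(\<Sum>i\<in>Phi_index d m. c i *\<^sub>R hat_coeffs A A' i) $ Inl 1 $ Inl 1 = c (Inl 0)"
    unfolding hat_coeffs_def sum_coeffs by (simp add: block_sum_def mat_def)
  hence c0: "c (Inl 0) = 0" unfolding * by simp
  have "case_sum A A' i $ a $ b = hat_coeffs A A' i $ Inr a $ Inr b" for i a b
    by (cases i) (auto simp: hat_coeffs_def block_sum_def)
  hence "(\<Sum>i\<in>Phi_index d m. c i *\<^sub>R case_sum A A' i) $ a $ b =
      (\<Sum>i\<in>Phi_index d m. c i *\<^sub>R hat_coeffs A A' i) $ Inr a $ Inr b" for a b
    by simp
  hence "(\<Sum>i\<in>Phi_index d m. c i *\<^sub>R case_sum A A' i) = 0"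
    unfolding * by (simp add: vec_eq_iff)
  hence "(\<Sum>i\<in>{1..d} <+> {1..m}. c i *\<^sub>R case_sum A A' i) = 0"
    unfolding sum_coeffs c0 by (simp add: sum.Plus)
  hence "\<forall>i\<in>{1..d} <+> {1..m}. c i = 0"
    using assms unfolding indep_hat_Phi_def
      lin_indep_family_iff[OF finite_Plus[OF finite_atLeastAtMost finite_atLeastAtMost]] by blast
  moreover have "Phi_index d m \<subseteq> insert (Inl 0) ({1..d} <+> {1..m})"
    by (auto simp: Plus_def)
  ultimately show "\<forall>i\<in>Phi_index d m. c i = 0" using c0 by blast
qed

lemma Phi_values:
  assumes "indep_Phi d m A A'"
  shows "linear (Phi d m A A' B)"
    and "p \<le> d \<Longrightarrow> Phi d m A A' B (A p) = B p"
    and "q \<in> {1..m} \<Longrightarrow> Phi d m A A' B (A' q) = 0"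
  using assms linear_linear_map_of[of "Phi_index d m" "case_sum A A'" "case_sum B (\<lambda>q. 0)"]
    linear_map_of_apply[of "Phi_index d m" "case_sum A A'" "Inl p" "case_sum B (\<lambda>q. 0)"]
    linear_map_of_apply[of "Phi_index d m" "case_sum A A'" "Inr q" "case_sum B (\<lambda>q. 0)"]
  by (auto simp: Phi_def indep_Phi_def Plus_def)

lemma hat_Phi_values:
  assumes "indep_hat_Phi d m A A'"
  shows "linear (hat_Phi d m A A' B)"
    and "hat_Phi d m A A' B ((mat 1 :: real^1^1) \<oplus>\<^sub>m A 0) = B 0"
    and "p \<in> {1..d} \<Longrightarrow> hat_Phi d m A A' B ((0 :: real^1^1) \<oplus>\<^sub>m A p) = B p"
    and "q \<in> {1..m} \<Longrightarrow> hat_Phi d m A A' B ((0 :: real^1^1) \<oplus>\<^sub>m A' q) = 0"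
  using hat_coeffs_indep[OF assms]
    linear_linear_map_of[of "Phi_index d m" "hat_coeffs A A'" "case_sum B (\<lambda>q. 0)"]
    linear_map_of_apply[of "Phi_index d m" "hat_coeffs A A'" "Inl 0" "case_sum B (\<lambda>q. 0)"]
    linear_map_of_apply[of "Phi_index d m" "hat_coeffs A A'" "Inl p" "case_sum B (\<lambda>q. 0)"]
    linear_map_of_apply[of "Phi_index d m" "hat_coeffs A A'" "Inr q" "case_sum B (\<lambda>q. 0)"]
  by (auto simp: hat_Phi_def hat_coeffs_def Plus_def)

lemma span_values: "span (case_sum B (\<lambda>q. 0) ` Phi_index d m) \<subseteq> calB d B"
  unfolding calB_def
  by (rule span_minimal[OF _ subspace_span])
    (auto simp: Plus_def image_Un image_image intro: span_base span_zero)

lemma Phi_in_calB: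
  assumes "indep_Phi d m A A'"
  shows "Phi d m A A' B X \<in> calB d B"
  using linear_map_of_in_span[of "Phi_index d m" "case_sum A A'"] assms span_values[of B d m]
  unfolding Phi_def indep_Phi_def by blast

lemma hat_Phi_in_calB:
  assumes "indep_hat_Phi d m A A'"
  shows "hat_Phi d m A A' B X \<in> calB d B"
  using linear_map_of_in_span[OF hat_coeffs_indep[OF assms]] span_values[of B d m]
  unfolding hat_Phi_def by blast

end

theory Submission
  imports Defs
begin

text \<open>
  Both maps send the homogenized pencil
  \<open>c\<^sub>0 A\<^sub>0 + \<Sum> c\<^sub>p A\<^sub>p + \<Sum> e\<^sub>q A'\<^sub>q\<close> (bordered by a \<open>1 \<times> 1\<close> block \<open>c\<^sub>0\<close> in the case of the
  hatted map) to \<open>c\<^sub>0 B\<^sub>0 + \<Sum> c\<^sub>p B\<^sub>p\<close>. At \<open>c\<^sub>0 = 1\<close> this says that \<open>A(x,y)\<close> is sent to \<open>B(x)\<close>, so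
  positivity gives the inclusion of the projection.

  Conversely, let the inclusion hold and let the homogenized pencil of \<open>A\<close> be positive
  semidefinite at \<open>(c\<^sub>0,c,e)\<close>. If \<open>c\<^sub>0 > 0\<close>, dividing by \<open>c\<^sub>0\<close> gives a point of \<open>S\<^sub>A\<close>, whose
  projection lies in \<open>S\<^sub>B\<close>. If \<open>c\<^sub>0 = 0\<close>, then \<open>(c,e)\<close> is a recession direction of the nonempty set
  \<open>S\<^sub>A\<close>, hence \<open>c\<close> is one of \<open>S\<^sub>B\<close>, and the linear part of \<open>B\<close> at \<open>c\<close> is
  positive semidefinite (\<open>psd_of_ray\<close>). Lemma \<open>psd_image_of_nonneg\<close> contains these
  two cases.

  So only \<open>c\<^sub>0 < 0\<close> has to be excluded. For the hatted map the extra block \<open>c\<^sub>0\<close> does exactly this. For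
  the other map boundedness does: normalizing \<open>c\<^sub>0 = -1\<close> and adding a point \<open>(x,y)\<close> of \<open>S\<^sub>A\<close>
  makes the constant terms cancel, so \<open>(x + c, y + e)\<close> is a recession direction and must vanish.
  Then both \<open>A(x,y)\<close> and \<open>-A(x,y)\<close> are positive semidefinite, so \<open>A(x,y) = 0\<close>, which contradicts
  linear independence (\<open>nonneg_of_bounded\<close>).
\<close>

section \<open>Positive semidefinite matrices\<close>

lemma transpose_add: "transpose (M + N) = transpose M + transpose (N :: real^'n^'n)"
  by (simp add: transpose_def vec_eq_iff)

lemma quadratic_form_add:
  fixes M N :: "real^'n^'n"
  shows "v \<bullet> ((M + N) *v v) = v \<bullet> (M *v v) + v \<bullet> (N *v v)"
  by (simp add: matrix_vector_mult_add_rdistrib inner_add_right)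

lemma quadratic_form_scaleR:
  fixes M :: "real^'n^'n"
  shows "v \<bullet> ((a *\<^sub>R M) *v v) = a * (v \<bullet> (M *v v))"
  by (simp flip: scaleR_matrix_vector_assoc)

lemma psd_add: "psd M \<Longrightarrow> psd N \<Longrightarrow> psd (M + N)"
  by (simp add: psd_def symmetric_matrix_def transpose_add quadratic_form_add)

lemma psd_scaleR: "psd M \<Longrightarrow> 0 \<le> a \<Longrightarrow> psd (a *\<^sub>R M)"
  by (simp add: psd_def symmetric_matrix_def transpose_scalar quadratic_form_scaleR)

text \<open>The cone of positive semidefinite matrices is closed, so it contains every direction in which
  it contains a ray. For a fixed vector this says that an affine function which is nonnegative on
  \<open>[0,\<infinity>)\<close> has nonnegative slope.\<close>

lemma psd_of_ray:
  fixes M N :: "real^'n^'n"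
  assumes ray: "\<And>t. 0 \<le> t \<Longrightarrow> psd (N + t *\<^sub>R M)"
  shows "psd M"
  unfolding psd_def
proof
  have "transpose (N + M) = N + M" "transpose N = N"
    using ray[of 1] ray[of 0] by (simp_all add: psd_def symmetric_matrix_def)
  then show "symmetric_matrix M"
    by (simp add: symmetric_matrix_def transpose_add)
  show "\<forall>v. 0 \<le> v \<bullet> (M *v v)"
  proof (rule allI, rule ccontr)
    fix v
    let ?n = "v \<bullet> (N *v v)" and ?m = "v \<bullet> (M *v v)"
    assume "\<not> 0 \<le> ?m"
    then have m: "?m < 0" by simp
    have *: "0 \<le> ?n + t * ?m" if "0 \<le> t" for t
      using ray[OF that] by (simp add: psd_def quadratic_form_add quadratic_form_scaleR)
    have "0 \<le> ?n" using *[of 0] by simp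
    \<comment> \<open>The affine function takes the value \<open>-1\<close> at this parameter.\<close>
    with m have "0 \<le> - ((?n + 1) / ?m)" by (simp add: divide_nonneg_neg)
    from *[OF this] m show False by simp
  qed
qed

text \<open>The cone of positive semidefinite matrices is pointed: if the quadratic form of a symmetric
  matrix vanishes, then so does the bilinear form, by polarization.\<close>

lemma psd_antisym:
  fixes M :: "real^'n^'n"
  assumes "psd M" "psd (- M)"
  shows "M = 0"
proof -
  have q: "v \<bullet> (M *v v) = 0" for v
    using assms quadratic_form_scaleR[of v "-1" M] unfolding psd_def
    by (metis mult_minus1 neg_0_le_iff_le order_antisym scaleR_minus1_left)
  have sym: "u \<bullet> (M *v w) = w \<bullet> (M *v u)" for u w
    using assms(1) unfolding psd_def symmetric_matrix_def
    by (metis dot_lmul_matrix inner_commute vector_transpose_matrix)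
  have "u \<bullet> (M *v w) = 0" for u w
    using q[of "u + w"] q[of u] q[of w] sym[of u w]
    by (simp add: matrix_vector_right_distrib inner_add_left inner_add_right)
  then have "M *v w = 0" for w by (metis inner_eq_zero_iff)
  then show ?thesis by (metis matrix_eq matrix_vector_mult_0)
qed

lemma block_sum_mult:
  "(M \<oplus>\<^sub>m N) *v v = (\<chi> i. case i of Inl a \<Rightarrow> (M *v (\<chi> a. v $ Inl a)) $ a
                             | Inr b \<Rightarrow> (N *v (\<chi> b. v $ Inr b)) $ b)"
  by (auto simp: vec_eq_iff matrix_vector_mult_def block_sum_def UNIV_Plus_UNIV[symmetric]
      sum.Plus simp del: UNIV_Plus_UNIV split: sum.split)

lemma quadratic_form_block_sum:
  "v \<bullet> ((M \<oplus>\<^sub>m N) *v v) =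
     (\<chi> a. v $ Inl a) \<bullet> (M *v (\<chi> a. v $ Inl a)) + (\<chi> b. v $ Inr b) \<bullet> (N *v (\<chi> b. v $ Inr b))"
  by (simp add: block_sum_mult inner_vec_def UNIV_Plus_UNIV[symmetric] sum.Plus
      del: UNIV_Plus_UNIV)

lemma symmetric_block_sum:
  "symmetric_matrix (M \<oplus>\<^sub>m N) \<longleftrightarrow> symmetric_matrix M \<and> symmetric_matrix N"
  by (auto simp: symmetric_matrix_def transpose_def vec_eq_iff block_sum_def split_sum_all)

lemma psd_block_sum: "psd (M \<oplus>\<^sub>m N) \<longleftrightarrow> psd M \<and> psd N"
proof
  assume psd: "psd (M \<oplus>\<^sub>m N)"
  \<comment> \<open>Vectors that are supported on one block see only that block.\<close>
  have "0 \<le> u \<bullet> (M *v u)" for u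
    using psd quadratic_form_block_sum[of "\<chi> i. case i of Inl a \<Rightarrow> u $ a | Inr b \<Rightarrow> 0" M N]
    unfolding psd_def by (metis (no_types, lifting) ext add_0_right inner_zero_left
      sum.case(1) sum.case(2) vec_lambda_beta vec_lambda_eta zero_vec_def)
  moreover have "0 \<le> w \<bullet> (N *v w)" for w
    using psd quadratic_form_block_sum[of "\<chi> i. case i of Inl a \<Rightarrow> 0 | Inr b \<Rightarrow> w $ b" M N]
    unfolding psd_def by (metis (no_types, lifting) ext add_0_left inner_zero_left
      sum.case(1) sum.case(2) vec_lambda_beta vec_lambda_eta zero_vec_def)
  ultimately show "psd M \<and> psd N"
    using psd by (simp add: psd_def symmetric_block_sum)
qed (simp add: psd_def symmetric_block_sum quadratic_form_block_sum)

lemma psd_scaled_mat_1: "psd (a *\<^sub>R mat 1 :: real^1^1) \<longleftrightarrow> 0 \<le> a"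
proof
  assume "psd (a *\<^sub>R mat 1 :: real^1^1)"
  then have "0 \<le> (1 :: real^1) \<bullet> ((a *\<^sub>R mat 1) *v 1)" by (simp add: psd_def)
  then show "0 \<le> a" unfolding quadratic_form_scaleR by (simp add: inner_vec_def)
next
  assume "0 \<le> a"
  moreover have "psd (mat 1 :: real^1^1)"
    by (simp add: psd_def symmetric_matrix_def transpose_mat)
  ultimately show "psd (a *\<^sub>R mat 1 :: real^1^1)" by (simp add: psd_scaleR)
qed


section \<open>Linear combinations of an indexed family\<close>

lemma span_image_combination:
  assumes "finite I" "X \<in> span (F ` I)"
  obtains c where "X = (\<Sum>i\<in>I. c i *\<^sub>R F i)"
proof -
  have "\<exists>c. X = (\<Sum>i\<in>I. c i *\<^sub>R F i)" using assms(2)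
  proof (induction rule: span_induct_alt)
    case base
    show ?case by (rule exI[of _ "\<lambda>_. 0"]) simp
  next
    case (step a v w)
    then obtain c j where c: "w = (\<Sum>i\<in>I. c i *\<^sub>R F i)" and j: "j \<in> I" "v = F j" by blast
    have "(\<Sum>i\<in>I. (c i + (if i = j then a else 0)) *\<^sub>R F i) =
        (\<Sum>i\<in>I. c i *\<^sub>R F i) + (\<Sum>i\<in>I. if i = j then a *\<^sub>R F i else 0)"
      unfolding sum.distrib[symmetric] by (intro sum.cong) (auto simp: scaleR_add_left)
    also have "\<dots> = a *\<^sub>R v + w" using c j assms(1) by simp
    finally show ?case by metis
  qed
  then show ?thesis using that by blast
qed

lemma linear_map_of_combination:
  assumes "lin_indep_family I F"
  shows "linear_map_of I F G (\<Sum>i\<in>I. c i *\<^sub>R F i) = (\<Sum>i\<in>I. c i *\<^sub>R G i)"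
  using linear_linear_map_of[OF assms, of G] linear_map_of_apply[OF assms, of _ G]
  by (simp add: linear_sum linear_scale)

text \<open>Written as one sum over the index set of the families that define the two linear maps, so that
  linearity applies to it termwise. The image pencil is the case of zero coefficients \<open>A'\<close>.\<close>

abbreviation hom_pencil ::
  "nat \<Rightarrow> nat \<Rightarrow> (nat \<Rightarrow> real^'n^'n) \<Rightarrow> (nat \<Rightarrow> real^'n^'n) \<Rightarrow> (nat + nat \<Rightarrow> real) \<Rightarrow> real^'n^'n" where
  "hom_pencil d m A A' c \<equiv> \<Sum>i\<in>Phi_index d m. c i *\<^sub>R case_sum A A' i"

lemma Phi_hom_pencil:
  assumes "indep_Phi d m A A'"
  shows "Phi d m A A' B (hom_pencil d m A A' c) = hom_pencil d m B (\<lambda>q. 0) c"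
  using assms unfolding Phi_def indep_Phi_def by (rule linear_map_of_combination)

lemma hat_Phi_hat_combination:
  assumes "indep_hat_Phi d m A A'"
  shows "hat_Phi d m A A' B (\<Sum>i\<in>Phi_index d m. c i *\<^sub>R hat_coeffs A A' i) =
    hom_pencil d m B (\<lambda>q. 0) c"
  unfolding hat_Phi_def by (rule linear_map_of_combination[OF hat_coeffs_indep[OF assms]])

lemma hat_combination:
  "(\<Sum>i\<in>Phi_index d m. c i *\<^sub>R hat_coeffs A A' i) =
     (c (Inl 0) *\<^sub>R mat 1 :: real^1^1) \<oplus>\<^sub>m hom_pencil d m A A' c"
  unfolding hat_coeffs_def sum_coeffs by (simp add: vec_eq_iff block_sum_def split_sum_all)

lemma psd_hat_combination:
  "psd (\<Sum>i\<in>Phi_index d m. c i *\<^sub>R hat_coeffs A A' i) \<longleftrightarrow>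
     0 \<le> c (Inl 0) \<and> psd (hom_pencil d m A A' c)"
  unfolding hat_combination psd_block_sum psd_scaled_mat_1 ..

lemma pencil2_eq_hom_pencil:
  "pencil2 d m A A' x y = hom_pencil d m A A' (case_sum (\<lambda>p. if p = 0 then 1 else x p) y)"
  unfolding sum_coeffs by (simp add: pencil2_def)

lemma pencil_eq_hom_pencil:
  "pencil d B x = hom_pencil d m B (\<lambda>q. 0) (case_sum (\<lambda>p. if p = 0 then 1 else x p) y)"
  unfolding sum_coeffs by (simp add: pencil_def)


section \<open>Projected spectrahedra\<close>

text \<open>Points of a spectrahedron are extensional functions. The next lemmas allow arbitrary coordinate
  functions instead, so that sums and multiples of points can be formed freely.\<close>

lemma pencil_restrict: "pencil d B (restrict x {1..d}) = pencil d B x"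
  by (simp add: pencil_def)

lemma pencil2_restrict:
  "pencil2 d m A A' (restrict x {1..d}) (restrict y {1..m}) = pencil2 d m A A' x y"
  by (simp add: pencil2_def)

lemma psd_pencil_of_inclusion:
  assumes "proj_spectrahedron d m A A' \<subseteq> spectrahedron d B" "psd (pencil2 d m A A' x y)"
  shows "psd (pencil d B x)"
proof -
  have "restrict x {1..d} \<in> proj_spectrahedron d m A A'"
    unfolding proj_spectrahedron_def
  proof (intro CollectI conjI bexI)
    show "psd (pencil2 d m A A' (restrict x {1..d}) (restrict y {1..m}))"
      using assms(2) by (simp only: pencil2_restrict)
  qed auto
  then have "psd (pencil d B (restrict x {1..d}))"
    using assms(1) by (auto simp: spectrahedron_def)
  then show ?thesis by (simp only: pencil_restrict)
qed

lemma bounded_pairsD: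
  assumes "bounded_pairs d m (spectrahedron2 d m A A')"
  obtains C where "\<And>x y. psd (pencil2 d m A A' x y) \<Longrightarrow>
    (\<Sum>p=1..d. (x p)\<^sup>2) + (\<Sum>q=1..m. (y q)\<^sup>2) \<le> C\<^sup>2"
proof -
  from assms obtain C where C: "\<And>x y. (x, y) \<in> spectrahedron2 d m A A' \<Longrightarrow>
      sqrt ((\<Sum>p=1..d. (x p)\<^sup>2) + (\<Sum>q=1..m. (y q)\<^sup>2)) \<le> C"
    unfolding bounded_pairs_def by fast
  show ?thesis
  proof
    fix x y
    assume "psd (pencil2 d m A A' x y)"
    then have "(restrict x {1..d}, restrict y {1..m}) \<in> spectrahedron2 d m A A'"
      by (simp add: spectrahedron2_def pencil2_restrict del: One_nat_def)
    from C[OF this] have "sqrt ((\<Sum>p=1..d. (x p)\<^sup>2) + (\<Sum>q=1..m. (y q)\<^sup>2)) \<le> C"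
      by simp
    then show "(\<Sum>p=1..d. (x p)\<^sup>2) + (\<Sum>q=1..m. (y q)\<^sup>2) \<le> C\<^sup>2"
      by (rule sqrt_le_D)
  qed
qed

lemma pencil2_add_direction:
  assumes "e (Inl 0) = 0"
  shows "pencil2 d m A A' (\<lambda>p. x p + t * e (Inl p)) (\<lambda>q. y q + t * e (Inr q)) =
    pencil2 d m A A' x y + t *\<^sub>R hom_pencil d m A A' e"
  unfolding sum_coeffs pencil2_def using assms
  by (simp add: scaleR_add_left scaleR_add_right sum.distrib scaleR_sum_right)

lemma pencil_add_direction:
  assumes "e (Inl 0) = 0"
  shows "pencil d B (\<lambda>p. x p + t * e (Inl p)) =
    pencil d B x + t *\<^sub>R hom_pencil d m B (\<lambda>q. 0) e"
  unfolding sum_coeffs pencil_def using assms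
  by (simp add: scaleR_add_left sum.distrib scaleR_sum_right)

lemma psd_recession_direction:
  assumes "psd (pencil2 d m A A' x y)" "psd (hom_pencil d m A A' e)" "e (Inl 0) = 0" "0 \<le> t"
  shows "psd (pencil2 d m A A' (\<lambda>p. x p + t * e (Inl p)) (\<lambda>q. y q + t * e (Inr q)))"
  unfolding pencil2_add_direction[where e = e, OF assms(3)]
  using assms by (intro psd_add psd_scaleR)

text \<open>Homogenizing turns the inclusion of convex sets into an inclusion of cones, as long as the
  homogenizing coordinate is nonnegative: positive values reduce to the inclusion itself by scaling,
  the value zero to an inclusion of recession cones.\<close>

lemma psd_image_of_nonneg:
  assumes ne: "proj_spectrahedron d m A A' \<noteq> {}"
    and sub: "proj_spectrahedron d m A A' \<subseteq> spectrahedron d B"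
    and psd: "psd (hom_pencil d m A A' c)" and nonneg: "0 \<le> c (Inl 0)"
  shows "psd (hom_pencil d m B (\<lambda>q. 0) c)"
proof (cases "c (Inl 0) = 0")
  case True
  from ne obtain x y where xy: "psd (pencil2 d m A A' x y)"
    unfolding proj_spectrahedron_def by blast
  show ?thesis
  proof (rule psd_of_ray)
    fix t :: real
    assume "0 \<le> t"
    from psd_pencil_of_inclusion[OF sub psd_recession_direction[OF xy psd True this]]
    show "psd (pencil d B x + t *\<^sub>R hom_pencil d m B (\<lambda>q. 0) c)"
      unfolding pencil_add_direction[where e = c and m = m, OF True] .
  qed
next
  case False
  let ?a = "c (Inl 0)"
  let ?x = "\<lambda>p. c (Inl p) / ?a" and ?y = "\<lambda>q. c (Inr q) / ?a"
  have A: "pencil2 d m A A' ?x ?y = (1 / ?a) *\<^sub>R hom_pencil d m A A' c"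
    and B: "hom_pencil d m B (\<lambda>q. 0) c = ?a *\<^sub>R pencil d B ?x"
    unfolding sum_coeffs pencil2_def pencil_def using False
    by (simp_all add: scaleR_add_right scaleR_sum_right)
  have "psd (pencil2 d m A A' ?x ?y)"
    unfolding A using psd nonneg by (intro psd_scaleR) simp_all
  then show ?thesis
    unfolding B using nonneg by (intro psd_scaleR psd_pencil_of_inclusion[OF sub])
qed

lemma bounded_recession_direction_zero:
  assumes bdd: "bounded_pairs d m (spectrahedron2 d m A A')"
    and xy: "psd (pencil2 d m A A' x y)"
    and psd: "psd (hom_pencil d m A A' e)" and e0: "e (Inl 0) = 0"
    and i: "i \<in> Phi_index d m"
  shows "e i = 0"
proof -
  from bounded_pairsD[OF bdd] obtain C where C: "\<And>x y. psd (pencil2 d m A A' x y) \<Longrightarrow>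
    (\<Sum>p=1..d. (x p)\<^sup>2) + (\<Sum>q=1..m. (y q)\<^sup>2) \<le> C\<^sup>2" by metis
  have bound: "(\<Sum>p=1..d. (x p + t * e (Inl p))\<^sup>2) + (\<Sum>q=1..m. (y q + t * e (Inr q))\<^sup>2) \<le> C\<^sup>2"
    if "0 \<le> t" for t
    by (rule C[OF psd_recession_direction[where e = e, OF xy psd e0 that]])
  \<comment> \<open>Along the ray every coordinate is an affine function of the parameter that stays bounded.\<close>
  have zero: "b = 0" if ab: "\<And>t. 0 \<le> t \<Longrightarrow> (a + t * b)\<^sup>2 \<le> C\<^sup>2" for a b :: real
  proof (rule ccontr)
    assume b: "b \<noteq> 0"
    let ?t = "(\<bar>a\<bar> + \<bar>C\<bar> + 1) / \<bar>b\<bar>"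
    have "\<bar>a + ?t * b\<bar> \<le> \<bar>C\<bar>" using ab[of ?t] by (simp add: abs_le_square_iff)
    moreover have "\<bar>?t * b\<bar> = \<bar>a\<bar> + \<bar>C\<bar> + 1" using b by (simp add: abs_mult)
    ultimately show False by linarith
  qed
  from i have "i = Inl 0 \<or> (\<exists>p\<in>{1..d}. i = Inl p) \<or> (\<exists>q\<in>{1..m}. i = Inr q)"
    by (auto simp: Plus_def Suc_le_eq)
  then consider "i = Inl 0" | p where "p \<in> {1..d}" "i = Inl p" | q where "q \<in> {1..m}" "i = Inr q"
    by blast
  then show ?thesis
  proof cases
    case 1
    then show ?thesis using e0 by simp
  next
    case (2 p)
    have "(x p + t * e (Inl p))\<^sup>2 \<le> C\<^sup>2" if "0 \<le> t" for t
    proof -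
      have "(x p + t * e (Inl p))\<^sup>2 \<le> (\<Sum>p=1..d. (x p + t * e (Inl p))\<^sup>2)"
        using 2 by (intro member_le_sum) auto
      moreover have "0 \<le> (\<Sum>q=1..m. (y q + t * e (Inr q))\<^sup>2)" by (simp add: sum_nonneg)
      ultimately show ?thesis using bound[OF that] by linarith
    qed
    from zero[OF this] 2 show ?thesis by simp
  next
    case (3 q)
    have "(y q + t * e (Inr q))\<^sup>2 \<le> C\<^sup>2" if "0 \<le> t" for t
    proof -
      have "(y q + t * e (Inr q))\<^sup>2 \<le> (\<Sum>q=1..m. (y q + t * e (Inr q))\<^sup>2)"
        using 3 by (intro member_le_sum) auto
      moreover have "0 \<le> (\<Sum>p=1..d. (x p + t * e (Inl p))\<^sup>2)" by (simp add: sum_nonneg)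
      ultimately show ?thesis using bound[OF that] by linarith
    qed
    from zero[OF this] 3 show ?thesis by simp
  qed
qed

text \<open>A positive semidefinite combination with \<open>c\<^sub>0 < 0\<close>, scaled to \<open>c\<^sub>0 = -1\<close> and added to a point
  \<open>A(x,y)\<close> of the spectrahedron, is a recession direction, hence zero. So \<open>-A(x,y)\<close> would be positive
  semidefinite, which forces a nontrivial linear relation with coefficient \<open>1\<close> at \<open>A\<^sub>0\<close>.\<close>

lemma nonneg_of_bounded:
  assumes indep: "indep_Phi d m A A'"
    and ne: "proj_spectrahedron d m A A' \<noteq> {}"
    and bdd: "bounded_pairs d m (spectrahedron2 d m A A')"
    and psd: "psd (hom_pencil d m A A' c)"
  shows "0 \<le> c (Inl 0)"
proof (rule ccontr)
  assume "\<not> 0 \<le> c (Inl 0)"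
  then have neg: "c (Inl 0) < 0" by simp
  let ?I = "Phi_index d m"
  let ?s = "- (1 / c (Inl 0))"
  from ne obtain x y where xy: "psd (pencil2 d m A A' x y)"
    unfolding proj_spectrahedron_def by blast
  define u where "u = case_sum (\<lambda>p. if p = 0 then 1 else x p) y"
  have u: "psd (hom_pencil d m A A' u)" "u (Inl 0) = 1"
    using xy by (simp_all add: u_def pencil2_eq_hom_pencil)
  have psd': "psd (?s *\<^sub>R hom_pencil d m A A' c)"
    using neg by (intro psd_scaleR psd) simp
  define e where "e i = u i + ?s * c i" for i
  have e_sum: "hom_pencil d m A A' e = hom_pencil d m A A' u + ?s *\<^sub>R hom_pencil d m A A' c"
    by (simp only: e_def scaleR_add_left sum.distrib scaleR_sum_right scaleR_scaleR)
  have "psd (hom_pencil d m A A' e)"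
    unfolding e_sum using u psd' by (intro psd_add)
  moreover have "e (Inl 0) = 0" using neg u by (simp add: e_def)
  ultimately have "\<And>i. i \<in> ?I \<Longrightarrow> e i = 0"
    using bounded_recession_direction_zero[OF bdd xy] by blast
  then have "hom_pencil d m A A' e = 0" by simp
  then have "?s *\<^sub>R hom_pencil d m A A' c = - hom_pencil d m A A' u"
    unfolding e_sum by (simp add: eq_neg_iff_add_eq_0 add.commute)
  with psd' u have "hom_pencil d m A A' u = 0"
    by (intro psd_antisym) simp_all
  then have "\<forall>i\<in>?I. u i = 0"
    using indep unfolding indep_Phi_def
    by (subst (asm) lin_indep_family_iff) (simp_all only: finite_Plus finite_atLeastAtMost, blast)
  moreover have "Inl 0 \<in> ?I" by auto
  ultimately show False using u by force
qed


section \<open>Positivity and inclusion\<close>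

lemma inclusion_of_psd_pencil:
  assumes "\<And>x y. psd (pencil2 d m A A' x y) \<Longrightarrow> psd (pencil d B x)"
  shows "proj_spectrahedron d m A A' \<subseteq> spectrahedron d B"
  using assms by (auto simp: proj_spectrahedron_def spectrahedron_def)

lemma inclusion_of_positive_Phi:
  assumes indep: "indep_Phi d m A A'" and pos: "positive_on (calA d m A A') (Phi d m A A' B)"
  shows "proj_spectrahedron d m A A' \<subseteq> spectrahedron d B"
proof (rule inclusion_of_psd_pencil)
  fix x y
  assume psd: "psd (pencil2 d m A A' x y)"
  have "pencil2 d m A A' x y \<in> calA d m A A'"
    unfolding pencil2_eq_hom_pencil calA_def by (intro span_sum span_scale span_base imageI)
  with pos psd have "psd (Phi d m A A' B (pencil2 d m A A' x y))"
    by (simp add: positive_on_def)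
  then show "psd (pencil d B x)"
    unfolding pencil2_eq_hom_pencil Phi_hom_pencil[OF indep] pencil_eq_hom_pencil[where m = m and y = y] .
qed

lemma inclusion_of_positive_hat_Phi:
  assumes indep: "indep_hat_Phi d m A A'"
    and pos: "positive_on (hat_calA d m A A') (hat_Phi d m A A' B)"
  shows "proj_spectrahedron d m A A' \<subseteq> spectrahedron d B"
proof (rule inclusion_of_psd_pencil)
  fix x y
  assume psd: "psd (pencil2 d m A A' x y)"
  define c where "c = case_sum (\<lambda>p. if p = 0 then 1 else x p) y"
  let ?X = "\<Sum>i\<in>Phi_index d m. c i *\<^sub>R hat_coeffs A A' i"
  have "psd ?X"
    using psd unfolding psd_hat_combination pencil2_eq_hom_pencil c_def by simp
  moreover have "?X \<in> hat_calA d m A A'"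
    unfolding hat_calA_def by (intro span_sum span_scale span_base imageI)
  ultimately have "psd (hat_Phi d m A A' B ?X)"
    using pos by (simp add: positive_on_def)
  then show "psd (pencil d B x)"
    unfolding hat_Phi_hat_combination[OF indep] c_def pencil_eq_hom_pencil[where m = m and y = y] .
qed

lemma positive_hat_Phi_of_inclusion:
  assumes indep: "indep_hat_Phi d m A A'"
    and ne: "proj_spectrahedron d m A A' \<noteq> {}"
    and sub: "proj_spectrahedron d m A A' \<subseteq> spectrahedron d B"
  shows "positive_on (hat_calA d m A A') (hat_Phi d m A A' B)"
  unfolding positive_on_def
proof (intro ballI impI)
  fix X
  assume "X \<in> hat_calA d m A A'" and psd: "psd X"
  then obtain c where X: "X = (\<Sum>i\<in>Phi_index d m. c i *\<^sub>R hat_coeffs A A' i)"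
    unfolding hat_calA_def
    using span_image_combination[OF finite_Plus[OF finite_atLeastAtMost finite_atLeastAtMost]] by metis
  from psd have "0 \<le> c (Inl 0)" "psd (hom_pencil d m A A' c)"
    unfolding X psd_hat_combination by auto
  then show "psd (hat_Phi d m A A' B X)"
    unfolding X hat_Phi_hat_combination[OF indep] by (intro psd_image_of_nonneg[OF ne sub])
qed

lemma positive_Phi_of_inclusion:
  assumes indep: "indep_Phi d m A A'"
    and ne: "proj_spectrahedron d m A A' \<noteq> {}"
    and bdd: "bounded_pairs d m (spectrahedron2 d m A A')"
    and sub: "proj_spectrahedron d m A A' \<subseteq> spectrahedron d B"
  shows "positive_on (calA d m A A') (Phi d m A A' B)"
  unfolding positive_on_def
proof (intro ballI impI)
  fix X
  assume "X \<in> calA d m A A'" and psd: "psd X"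
  then obtain c where X: "X = hom_pencil d m A A' c"
    unfolding calA_def
    using span_image_combination[OF finite_Plus[OF finite_atLeastAtMost finite_atLeastAtMost]] by metis
  from psd show "psd (Phi d m A A' B X)"
    unfolding X Phi_hom_pencil[OF indep]
    by (intro psd_image_of_nonneg[OF ne sub] nonneg_of_bounded[OF indep ne bdd])
qed

theorem theorem5p14:
  fixes d m :: nat
    and A A' :: "nat \<Rightarrow> real^'k^'k"
    and B :: "nat \<Rightarrow> real^'l^'l"
  assumes "\<And>p. p \<in> {0..d} \<Longrightarrow> symmetric_matrix (A p)"
    and "\<And>q. q \<in> {1..m} \<Longrightarrow> symmetric_matrix (A' q)"
    and "\<And>p. p \<in> {0..d} \<Longrightarrow> symmetric_matrix (B p)"
  shows
    "((indep_Phi d m A A' \<and> positive_on (calA d m A A') (Phi d m A A' B)) \<or>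
      (indep_hat_Phi d m A A' \<and> positive_on (hat_calA d m A A') (hat_Phi d m A A' B))
        \<longrightarrow> proj_spectrahedron d m A A' \<subseteq> spectrahedron d B) \<and>
     (indep_hat_Phi d m A A' \<and> proj_spectrahedron d m A A' \<noteq> {} \<and>
      proj_spectrahedron d m A A' \<subseteq> spectrahedron d B
        \<longrightarrow> positive_on (hat_calA d m A A') (hat_Phi d m A A' B)) \<and>
     (indep_Phi d m A A' \<and> proj_spectrahedron d m A A' \<noteq> {} \<and>
      bounded_pairs d m (spectrahedron2 d m A A') \<and>
      proj_spectrahedron d m A A' \<subseteq> spectrahedron d B
        \<longrightarrow> positive_on (calA d m A A') (Phi d m A A' B))"
  using inclusion_of_positive_Phi[of d m A A' B] inclusion_of_positive_hat_Phi[of d m A A' B]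
    positive_hat_Phi_of_inclusion[of d m A A' B] positive_Phi_of_inclusion[of d m A A' B]
  by blast

end
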